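(* Let $E$ be a Banach lattice with property (d). If $A \subset E$ is an almost limited set, then its solid hull $\mathrm{sol}(A)$ is also an almost limited set.
   Context: All Banach spaces and Banach lattices are real; $E'$ denotes the topological dual of $E$, a Banach lattice with the dual order. A sequence $(f_n)$ in a Banach lattice is disjoint if $|f_n| \wedge |f_m| = 0$ for $n \neq m$. A Banach lattice $E$ has property (d) if $|f_n| \to 0$ in the weak* topology for every disjoint weak* null sequence $(f_n) \subset E'$. A bounded set $A \subset E$ is almost limited if every disjoint weak* null sequence $(f_n)$ in $E'$ converges uniformly to zero on $A$, i.e. $\sup_{x \in A} |f_n(x)| \to 0$. A set $S \subset E$ is solid if $|y| \leq |x|$ with $x \in S$ implies $y \in S$; the solid hull $\mathrm{sol}(A)$ is the smallest solid set containing $A$. *)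

theory Defs
  imports "HOL-Analysis.Analysis" "HOL-Library.Lattice_Algebras"
begin

section \<open>Banach lattices\<close>

class banach_lattice = banach + ordered_real_vector + lattice_ab_group_add_abs +
  assumes norm_abs_mono: "\<bar>x\<bar> \<le> \<bar>y\<bar> \<Longrightarrow> norm x \<le> norm y"

instance real :: banach_lattice
  by standard simp

definition solid :: "'a::banach_lattice set \<Rightarrow> bool"
  where "solid S \<longleftrightarrow> (\<forall>x\<in>S. \<forall>y. \<bar>y\<bar> \<le> \<bar>x\<bar> \<longrightarrow> y \<in> S)"

text \<open>The solid hull of \<open>A\<close> is \<open>solid hull A\<close>; it is solid, hence the smallest solid superset.\<close>

lemma solid_solid_hull: "solid (solid hull A)"
  by (rule hull_in) (unfold solid_def, blast)


section \<open>The dual Banach lattice\<close>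

text \<open>
  The topological dual of \<open>'a\<close> is \<open>'a \<Rightarrow>\<^sub>L real\<close>. Its order cannot be
  supplied as a lattice instance, because \<open>'a \<Rightarrow>\<^sub>L 'b\<close> is not a lattice for an arbitrary
  Banach lattice \<open>'b\<close>. Hence the order and the lattice operations are defined explicitly;
  that the suprema and infima exist is proved below.
\<close>

definition dual_le :: "('a::banach_lattice \<Rightarrow>\<^sub>L real) \<Rightarrow> ('a \<Rightarrow>\<^sub>L real) \<Rightarrow> bool"
  where "dual_le f g \<longleftrightarrow> (\<forall>x\<ge>0. blinfun_apply f x \<le> blinfun_apply g x)"

definition is_dual_sup ::
    "('a::banach_lattice \<Rightarrow>\<^sub>L real) \<Rightarrow> ('a \<Rightarrow>\<^sub>L real) \<Rightarrow> ('a \<Rightarrow>\<^sub>L real) \<Rightarrow> bool"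
  where "is_dual_sup f g h \<longleftrightarrow>
    dual_le f h \<and> dual_le g h \<and> (\<forall>k. dual_le f k \<longrightarrow> dual_le g k \<longrightarrow> dual_le h k)"

definition is_dual_inf ::
    "('a::banach_lattice \<Rightarrow>\<^sub>L real) \<Rightarrow> ('a \<Rightarrow>\<^sub>L real) \<Rightarrow> ('a \<Rightarrow>\<^sub>L real) \<Rightarrow> bool"
  where "is_dual_inf f g h \<longleftrightarrow>
    dual_le h f \<and> dual_le h g \<and> (\<forall>k. dual_le k f \<longrightarrow> dual_le k g \<longrightarrow> dual_le k h)"

definition dual_sup ::
    "('a::banach_lattice \<Rightarrow>\<^sub>L real) \<Rightarrow> ('a \<Rightarrow>\<^sub>L real) \<Rightarrow> ('a \<Rightarrow>\<^sub>L real)"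
  where "dual_sup f g = (THE h. is_dual_sup f g h)"

definition dual_inf ::
    "('a::banach_lattice \<Rightarrow>\<^sub>L real) \<Rightarrow> ('a \<Rightarrow>\<^sub>L real) \<Rightarrow> ('a \<Rightarrow>\<^sub>L real)"
  where "dual_inf f g = (THE h. is_dual_inf f g h)"

definition dual_abs :: "('a::banach_lattice \<Rightarrow>\<^sub>L real) \<Rightarrow> ('a \<Rightarrow>\<^sub>L real)"
  where "dual_abs f = dual_sup f (- f)"


subsection \<open>The lattice operations of the dual are well defined\<close>

lemma norm_mono_nonneg:
  fixes x y :: "'a::banach_lattice"
  assumes "0 \<le> x" "x \<le> y" shows "norm x \<le> norm y"
  using assms by (intro norm_abs_mono) (simp add: abs_of_nonneg order_trans[OF assms])

lemma dual_le_refl: "dual_le f f"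
  by (simp add: dual_le_def)

lemma dual_le_trans: "dual_le f g \<Longrightarrow> dual_le g h \<Longrightarrow> dual_le f h"
  by (meson dual_le_def order_trans)

lemma dual_le_minus: "dual_le (- f) (- g) \<longleftrightarrow> dual_le g f"
  by (simp add: dual_le_def uminus_blinfun.rep_eq)

lemma dual_le_antisym:
  assumes "dual_le f g" "dual_le g f"
  shows "f = g"
proof (rule blinfun_eqI)
  fix x :: 'a
  have eq: "blinfun_apply f y = blinfun_apply g y" if "0 \<le> y" for y
    using assms that by (simp add: dual_le_def order_antisym)
  have x: "x = pprt x - pprt (- x)"
    using prts[of x] by (simp add: pprt_neg)
  have "blinfun_apply f (pprt x - pprt (- x)) = blinfun_apply g (pprt x - pprt (- x))"
    by (simp add: blinfun.diff_right eq)
  with x show "blinfun_apply f x = blinfun_apply g x" by simp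
qed

lemma riesz_decomposition:
  fixes x y z :: "'a::lattice_ab_group_add"
  assumes "0 \<le> z" "z \<le> x + y" "0 \<le> x" "0 \<le> y"
  obtains u v where "0 \<le> u" "u \<le> x" "0 \<le> v" "v \<le> y" "z = u + v"
proof
  show "0 \<le> inf z x" "inf z x \<le> x" using assms by auto
  show "0 \<le> z - inf z x" by (simp only: diff_ge_0_iff_ge inf_le1)
  have "z - inf z x = sup 0 (z - x)"
    by (simp add: diff_inf_eq_sup add_sup_distrib_left)
  also have "\<dots> \<le> y" using assms by (simp add: algebra_simps)
  finally show "z - inf z x \<le> y" .
  show "z = inf z x + (z - inf z x)" by (simp only: add_diff_cancel_left' add_diff_eq)
qed

text \<open>Riesz--Kantorovich formula, first on the positive cone.\<close>

lemma is_dual_sup_exists: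
  fixes f g :: "'a::banach_lattice \<Rightarrow>\<^sub>L real"
  shows "\<exists>h. is_dual_sup f g h \<and>
    (\<forall>x\<ge>0. blinfun_apply h x = (SUP y\<in>{0..x}. blinfun_apply f y + blinfun_apply g (x - y)))"
proof -
  define F where "F = (\<lambda>x y. blinfun_apply f y + blinfun_apply g (x - y))"
  define p where "p = (\<lambda>x. SUP y\<in>{0..x}. F x y)"
  define C where "C = norm f + norm g"
  have C0: "0 \<le> C" by (simp add: C_def)
  have Fb: "\<bar>F x y\<bar> \<le> C * norm x" if "0 \<le> y" "y \<le> x" for x y
  proof -
    have "\<bar>blinfun_apply f y\<bar> \<le> norm f * norm y" 
      using norm_blinfun[of f y] by simp
    also have "\<dots> \<le> norm f * norm x"
      using norm_mono_nonneg[OF that] by (intro mult_left_mono) auto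
    finally have 1: "\<bar>blinfun_apply f y\<bar> \<le> norm f * norm x" .
    have "\<bar>blinfun_apply g (x - y)\<bar> \<le> norm g * norm (x - y)" 
      using norm_blinfun[of g "x - y"] by simp
    also have "\<dots> \<le> norm g * norm x"
      using norm_mono_nonneg[of "x - y" x] that by (intro mult_left_mono) auto
    finally have 2: "\<bar>blinfun_apply g (x - y)\<bar> \<le> norm g * norm x" .
    show ?thesis using 1 2 by (simp add: F_def C_def algebra_simps)
  qed
  have bdd: "bdd_above (F x ` {0..x})" for x
  proof (rule bdd_aboveI2)
    fix y assume "y \<in> {0..x}"
    then show "F x y \<le> C * norm x" using Fb[of y x] by auto
  qed
  have p_ge: "F x y \<le> p x" if "0 \<le> y" "y \<le> x" for x y
    unfolding p_def using that by (intro cSUP_upper[OF _ bdd]) auto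
  have p_le: "p x \<le> c" if "0 \<le> x" "\<And>y. 0 \<le> y \<Longrightarrow> y \<le> x \<Longrightarrow> F x y \<le> c" for x c
    unfolding p_def using that by (intro cSUP_least) auto
  have pb: "\<bar>p x\<bar> \<le> C * norm x" if "0 \<le> x" for x
  proof -
    have "p x \<le> C * norm x" using Fb[of _ x] that by (intro p_le) force+
    moreover have "- (C * norm x) \<le> p x" using p_ge[of 0 x] Fb[of 0 x] that by auto
    ultimately show ?thesis by simp
  qed
  have p_add: "p (x + y) = p x + p y" if xy: "0 \<le> x" "0 \<le> y" for x y
  proof (rule order_antisym)
    show "p (x + y) \<le> p x + p y"
    proof (rule p_le)
      fix z assume "0 \<le> z" "z \<le> x + y"
      then obtain u v where uv: "0 \<le> u" "u \<le> x" "0 \<le> v" "v \<le> y" "z = u + v"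
        using riesz_decomposition xy by metis
      have e: "x + y - z = (x - u) + (y - v)" using uv(5) by simp
      have "F (x + y) z = F x u + F y v"
        unfolding F_def e unfolding uv(5) by (simp add: blinfun.add_right)
      with p_ge[OF uv(1,2)] p_ge[OF uv(3,4)] show "F (x + y) z \<le> p x + p y" by simp
    qed (use xy in simp)
    have "F x u + F y v \<le> p (x + y)" if "0 \<le> u" "u \<le> x" "0 \<le> v" "v \<le> y" for u v
    proof -
      have e: "x + y - (u + v) = (x - u) + (y - v)" by simp
      have "F x u + F y v = F (x + y) (u + v)"
        unfolding F_def e by (simp add: blinfun.add_right)
      with p_ge[of "u + v" "x + y"] that show ?thesis by (simp add: add_mono)
    qed
    then have "F x u \<le> p (x + y) - F y v" if "0 \<le> u" "u \<le> x" "0 \<le> v" "v \<le> y" for u v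
      using that by (simp add: algebra_simps)
    then have "p x \<le> p (x + y) - F y v" if "0 \<le> v" "v \<le> y" for v
      using that xy by (intro p_le) auto
    then have "F y v \<le> p (x + y) - p x" if "0 \<le> v" "v \<le> y" for v
      using that by (simp add: algebra_simps)
    then have "p y \<le> p (x + y) - p x" using xy by (intro p_le) auto
    then show "p x + p y \<le> p (x + y)" by simp
  qed
  have p_scale_le: "p (a *\<^sub>R x) \<le> a * p x" if "0 < a" "0 \<le> x" for a x
  proof (rule p_le)
    show "0 \<le> a *\<^sub>R x" using that by (simp add: scaleR_nonneg_nonneg)
    fix y assume y: "0 \<le> y" "y \<le> a *\<^sub>R x"
    define w where "w = inverse a *\<^sub>R y"
    have y_eq: "y = a *\<^sub>R w" using that by (simp add: w_def)
    have w0: "0 \<le> w" using y that by (simp add: w_def scaleR_nonneg_nonneg)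
    have "w \<le> inverse a *\<^sub>R (a *\<^sub>R x)"
      unfolding w_def using y that by (intro scaleR_left_mono) auto
    then have w1: "w \<le> x" using that by simp
    have "F (a *\<^sub>R x) y = a * F x w"
      unfolding F_def y_eq scaleR_diff_right[symmetric]
      by (simp only: blinfun.scaleR_right real_scaleR_def distrib_left)
    also have "\<dots> \<le> a * p x" using p_ge[OF w0 w1] that by simp
    finally show "F (a *\<^sub>R x) y \<le> a * p x" .
  qed
  have p_scale: "p (a *\<^sub>R x) = a * p x" if a: "0 < a" and x: "0 \<le> x" for a x
  proof (rule order_antisym)
    have "p (inverse a *\<^sub>R (a *\<^sub>R x)) \<le> inverse a * p (a *\<^sub>R x)"
      using a x by (intro p_scale_le) (auto simp: scaleR_nonneg_nonneg)
    then have "p x \<le> inverse a * p (a *\<^sub>R x)" using a by simp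
    then show "a * p x \<le> p (a *\<^sub>R x)" using a by (simp add: field_simps)
  qed (use that p_scale_le in auto)
  have p0: "p 0 = 0" using p_add[of 0 0] by simp
  define H where "H = (\<lambda>x. p (pprt x) - p (pprt (- x)))"
  have pp: "x = pprt x - pprt (- x)" for x :: 'a
    using prts[of x] by (simp add: pprt_neg)
  have H_eq: "H x = p u - p v" if "0 \<le> u" "0 \<le> v" "x = u - v" for x u v
  proof -
    have swap: "a + d = c + b" if "a - b = c - d" for a b c d :: 'a
      using that by (simp add: algebra_simps)
    have "pprt x + v = u + pprt (- x)"
      by (rule swap) (metis pp that(3))
    then have "p (pprt x) + p v = p u + p (pprt (- x))"
      using that by (metis p_add zero_le_pprt)
    then show ?thesis by (simp add: H_def)
  qed
  have H_pos: "H x = p x" if "0 \<le> x" for x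
    using H_eq[of x 0 x] that p0 by simp
  have H_add: "H (x + y) = H x + H y" for x y
  proof -
    have "H (x + y) = p (pprt x + pprt y) - p (pprt (- x) + pprt (- y))"
    proof (rule H_eq)
      show "x + y = pprt x + pprt y - (pprt (- x) + pprt (- y))"
        using pp[of x] pp[of y] by (metis add_diff_add)
    qed auto
    then show ?thesis by (simp add: H_def p_add)
  qed
  have H_pos_scale: "H (a *\<^sub>R x) = a * H x" if "0 < a" for a x
  proof -
    have "H (a *\<^sub>R x) = p (a *\<^sub>R pprt x) - p (a *\<^sub>R pprt (- x))"
    proof (rule H_eq)
      show "a *\<^sub>R x = a *\<^sub>R pprt x - a *\<^sub>R pprt (- x)"
        using pp[of x] by (metis scaleR_diff_right)
    qed (use that in \<open>auto simp: scaleR_nonneg_nonneg\<close>)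
    then show ?thesis using that by (simp add: H_def p_scale algebra_simps)
  qed
  have H_neg: "H (- x) = - H x" for x by (simp add: H_def)
  have H_scale: "H (a *\<^sub>R x) = a * H x" for a x
  proof (cases a "0::real" rule: linorder_cases)
    case less
    then have "H (a *\<^sub>R x) = H (- ((- a) *\<^sub>R x))" by simp
    also have "\<dots> = - (- a * H x)" using less by (simp only: H_neg H_pos_scale[of "- a"])
    finally show ?thesis by simp
  next
    case equal
    then show ?thesis by (simp add: H_pos p0)
  next
    case greater
    then show ?thesis by (rule H_pos_scale)
  qed
  have Hb: "norm (H x) \<le> norm x * (2 * C)" for x
  proof -
    have n: "norm (pprt z) \<le> norm z" for z :: 'a
    proof (rule norm_abs_mono)
      have "pprt z \<le> \<bar>z\<bar>" by (simp add: pprt_def abs_ge_self)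
      then show "\<bar>pprt z\<bar> \<le> \<bar>z\<bar>" by (simp add: abs_of_nonneg)
    qed
    have q: "\<bar>p (pprt z)\<bar> \<le> C * norm z" for z
      using pb[of "pprt z"] mult_left_mono[OF n[of z] C0] by simp
    have "\<bar>H x\<bar> \<le> \<bar>p (pprt x)\<bar> + \<bar>p (pprt (- x))\<bar>"
      unfolding H_def by (rule abs_triangle_ineq4)
    with q[of x] q[of "- x"] have "\<bar>H x\<bar> \<le> C * norm x + C * norm x" by simp
    then show ?thesis by (simp add: algebra_simps)
  qed
  have bl: "bounded_linear H"
    by (rule bounded_linear_intro[OF H_add _ Hb]) (simp add: H_scale)
  define h where "h = Blinfun H"
  have h_apply: "blinfun_apply h = H"
    by (simp add: h_def bounded_linear_Blinfun_apply[OF bl])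
  have "dual_le f h"
    using p_ge[of x x for x] by (auto simp: dual_le_def h_apply H_pos F_def)
  moreover have "dual_le g h"
    using p_ge[of 0 x for x] by (auto simp: dual_le_def h_apply H_pos F_def)
  moreover have "dual_le h k" if k: "dual_le f k" "dual_le g k" for k
    unfolding dual_le_def
  proof (intro allI impI)
    fix x :: 'a assume x: "0 \<le> x"
    have "p x \<le> blinfun_apply k x"
    proof (rule p_le[OF x])
      fix y assume y: "0 \<le> y" "y \<le> x"
      have "F x y \<le> blinfun_apply k y + blinfun_apply k (x - y)"
        unfolding F_def using k y by (intro add_mono) (auto simp: dual_le_def)
      then show "F x y \<le> blinfun_apply k x" by (simp add: blinfun.diff_right)
    qed
    then show "blinfun_apply h x \<le> blinfun_apply k x" by (simp add: h_apply H_pos x)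
  qed
  ultimately have "is_dual_sup f g h" by (simp add: is_dual_sup_def)
  moreover have "\<forall>x\<ge>0. blinfun_apply h x =
      (SUP y\<in>{0..x}. blinfun_apply f y + blinfun_apply g (x - y))"
    by (simp add: h_apply H_pos p_def F_def)
  ultimately show ?thesis by blast
qed

lemma is_dual_sup_unique: "is_dual_sup f g h \<Longrightarrow> is_dual_sup f g h' \<Longrightarrow> h = h'"
  unfolding is_dual_sup_def by (blast intro: dual_le_antisym)

lemma is_dual_inf_unique: "is_dual_inf f g h \<Longrightarrow> is_dual_inf f g h' \<Longrightarrow> h = h'"
  unfolding is_dual_inf_def by (blast intro: dual_le_antisym)

lemma dual_sup_eqI: "is_dual_sup f g h \<Longrightarrow> dual_sup f g = h"
  unfolding dual_sup_def by (blast intro: the_equality is_dual_sup_unique)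

lemma dual_inf_eqI: "is_dual_inf f g h \<Longrightarrow> dual_inf f g = h"
  unfolding dual_inf_def by (blast intro: the_equality is_dual_inf_unique)

lemma is_dual_sup_dual_sup: "is_dual_sup f g (dual_sup f g)"
  using is_dual_sup_exists[of f g] dual_sup_eqI by metis

lemma dual_sup_apply:
  "0 \<le> x \<Longrightarrow> blinfun_apply (dual_sup f g) x =
    (SUP y\<in>{0..x}. blinfun_apply f y + blinfun_apply g (x - y))"
  using is_dual_sup_exists[of f g] dual_sup_eqI by metis

lemma is_dual_inf_uminus: "is_dual_sup (- f) (- g) h \<Longrightarrow> is_dual_inf f g (- h)"
  unfolding is_dual_sup_def is_dual_inf_def by (metis dual_le_minus minus_minus)

lemma is_dual_inf_dual_inf: "is_dual_inf f g (dual_inf f g)"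
  using is_dual_inf_uminus[OF is_dual_sup_dual_sup] dual_inf_eqI by metis

lemma dual_inf_eq_neg_sup: "dual_inf f g = - dual_sup (- f) (- g)"
  by (intro dual_inf_eqI is_dual_inf_uminus is_dual_sup_dual_sup)


section \<open>Weak* null sequences, property (d), almost limited sets\<close>

text \<open>
  The topology of pointwise convergence on \<open>'a \<Rightarrow>\<^sub>L real\<close>, which the library calls
  the strong operator topology, is the weak* topology.
\<close>

definition weak_star_null :: "(nat \<Rightarrow> 'a::banach_lattice \<Rightarrow>\<^sub>L real) \<Rightarrow> bool"
  where "weak_star_null f \<longleftrightarrow> limitin strong_operator_topology f 0 sequentially"

lemma weak_star_null_iff:
  "weak_star_null f \<longleftrightarrow> (\<forall>x. (\<lambda>n. blinfun_apply (f n) x) \<longlonglongrightarrow> 0)"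
proof
  assume "weak_star_null f"
  then show "\<forall>x. (\<lambda>n. blinfun_apply (f n) x) \<longlonglongrightarrow> 0"
    using continuous_map_limit[OF strong_operator_topology_continuous_evaluation]
    by (fastforce simp: weak_star_null_def comp_def)
next
  assume pw: "\<forall>x. (\<lambda>n. blinfun_apply (f n) x) \<longlonglongrightarrow> 0"
  have lim: "limitin euclidean (\<lambda>n. blinfun_apply (f n)) (\<lambda>x. 0) sequentially"
    unfolding euclidean_product_topology[symmetric] using pw
    by (simp add: limitin_componentwise)
  show "weak_star_null f"
    unfolding weak_star_null_def limitin_def
  proof (intro conjI allI impI)
    fix U :: "('a \<Rightarrow>\<^sub>L real) set"
    assume U: "openin strong_operator_topology U \<and> 0 \<in> U"
    then obtain V where V: "open V" "U = blinfun_apply -` V"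
      by (auto simp: strong_operator_topology_def openin_pullback_topology)
    have "(\<lambda>x. 0) \<in> V"
      using U V(2) by (simp add: zero_blinfun.rep_eq)
    with lim V(1) have "\<forall>\<^sub>F n in sequentially. blinfun_apply (f n) \<in> V"
      unfolding limitin_def by auto
    then show "\<forall>\<^sub>F n in sequentially. f n \<in> U" by (simp add: V(2))
  qed (simp add: strong_operator_topology_topspace)
qed

definition dual_disjoint_seq :: "(nat \<Rightarrow> 'a::banach_lattice \<Rightarrow>\<^sub>L real) \<Rightarrow> bool"
  where "dual_disjoint_seq f \<longleftrightarrow>
    (\<forall>n m. n \<noteq> m \<longrightarrow> dual_inf (dual_abs (f n)) (dual_abs (f m)) = 0)"

definition property_d :: "'a::banach_lattice itself \<Rightarrow> bool"
  where "property_d (_ :: 'a itself) \<longleftrightarrow>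
    (\<forall>f :: nat \<Rightarrow> 'a \<Rightarrow>\<^sub>L real. dual_disjoint_seq f \<longrightarrow> weak_star_null f \<longrightarrow>
      weak_star_null (\<lambda>n. dual_abs (f n)))"

text \<open>
  Uniform convergence is used instead of \<open>(\<lambda>n. SUP x\<in>A. \<bar>f n x\<bar>) \<longlonglongrightarrow> 0\<close>
  because \<open>Sup {}\<close> is unspecified on the reals; for nonempty bounded \<open>A\<close> the two agree
  (lemma \<open>uniform_limit_zero_iff_SUP\<close>).
\<close>

definition almost_limited :: "'a::banach_lattice set \<Rightarrow> bool"
  where "almost_limited A \<longleftrightarrow> bounded A \<and>
    (\<forall>f :: nat \<Rightarrow> 'a \<Rightarrow>\<^sub>L real. dual_disjoint_seq f \<longrightarrow> weak_star_null f \<longrightarrow>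
      uniform_limit A (\<lambda>n. blinfun_apply (f n)) (\<lambda>x. 0) sequentially)"

lemma uniform_limit_zero_iff_SUP:
  fixes f :: "nat \<Rightarrow> 'a::banach_lattice \<Rightarrow>\<^sub>L real"
  assumes "bounded A" "A \<noteq> {}"
  shows "uniform_limit A (\<lambda>n. blinfun_apply (f n)) (\<lambda>x. 0) sequentially \<longleftrightarrow>
    (\<lambda>n. SUP x\<in>A. \<bar>blinfun_apply (f n) x\<bar>) \<longlonglongrightarrow> 0"
    (is "?L \<longleftrightarrow> ?S \<longlonglongrightarrow> 0")
proof -
  have bdd: "bdd_above ((\<lambda>x. \<bar>blinfun_apply (f n) x\<bar>) ` A)" for n
    using bounded_linear_image[OF assms(1) blinfun.bounded_linear_right[of "f n"]]
    by (auto simp: bounded_iff bdd_above_def)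
  have ub: "\<bar>blinfun_apply (f n) x\<bar> \<le> ?S n" if "x \<in> A" for n x
    using that by (rule cSUP_upper[OF _ bdd])
  obtain a where a: "a \<in> A" using assms(2) by blast
  have S0: "0 \<le> ?S n" for n
    using ub[OF a] abs_ge_zero order_trans by blast
  show ?thesis
  proof
    assume L: ?L
    show "?S \<longlonglongrightarrow> 0"
    proof (rule tendstoI)
      fix e :: real assume e: "0 < e"
      have "\<forall>\<^sub>F n in sequentially. \<forall>x\<in>A. \<bar>blinfun_apply (f n) x\<bar> < e / 2"
        using uniform_limitD[OF L, of "e / 2"] e by (simp add: dist_real_def)
      then show "\<forall>\<^sub>F n in sequentially. dist (?S n) 0 < e"
      proof eventually_elim
        case (elim n)
        then have "?S n \<le> e / 2" using assms(2) by (intro cSUP_least) force+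
        with S0[of n] e show ?case by (simp add: dist_real_def)
      qed
    qed
  next
    assume S: "?S \<longlonglongrightarrow> 0"
    show ?L
    proof (rule uniform_limitI)
      fix e :: real assume "0 < e"
      with S have "\<forall>\<^sub>F n in sequentially. dist (?S n) 0 < e" by (rule tendstoD)
      then show "\<forall>\<^sub>F n in sequentially. \<forall>x\<in>A. dist (blinfun_apply (f n) x) 0 < e"
      proof eventually_elim
        case (elim n)
        show ?case
        proof
          fix x assume "x \<in> A"
          from ub[OF this, of n] elim S0[of n] show "dist (blinfun_apply (f n) x) 0 < e"
            by (simp add: dist_real_def)
        qed
      qed
    qed
  qed
qed

end

theory Submission
  imports Defs
begin

text \<open>
  For every \<open>x\<close>, splitting \<open>\<bar>f\<bar>\<close> along the band generated by \<open>x\<^sup>+\<close> yields a functional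
  \<open>g\<close> with \<open>\<bar>g\<bar> \<le> \<bar>f\<bar>\<close> and \<open>g x = \<bar>f\<bar> \<bar>x\<bar>\<close>. If \<open>\<bar>y\<bar> \<le> \<bar>x\<bar>\<close>, then \<open>\<bar>f y\<bar> \<le> g x\<close>. A disjoint weak*
  null sequence \<open>f\<^sub>n\<close> that is large at points of the solid hull of \<open>A\<close> is thereby turned into a
  sequence \<open>g\<^sub>n\<close> that is large at points of \<open>A\<close>; domination by \<open>\<bar>f\<^sub>n\<bar>\<close> keeps it disjoint, and
  by property (d) also weak* null.
\<close>

section \<open>Vector lattices\<close>

text \<open>Distributing \<open>+\<close> over \<open>inf\<close> turns the right side into the
  infimum of \<open>x + y\<close>, \<open>x + a\<close>, \<open>a + y\<close> and
  \<open>a + a\<close>, each of which lies above \<open>x + y\<close> or above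
  \<open>a\<close>.\<close>

lemma inf_add_le:
  fixes x y a :: "'a::lattice_ab_group_add"
  assumes "0 \<le> x" "0 \<le> y" "0 \<le> a"
  shows "inf (x + y) a \<le> inf x a + inf y a"
proof -
  have "inf (x + y) a \<le> x + a" "inf (x + y) a \<le> a + y" "inf (x + y) a \<le> a + a"
    using assms by (meson inf_le2 order_trans add_increasing add_increasing2 order_refl)+
  then show ?thesis by (simp add: add_inf_distrib_left add_inf_distrib_right)
qed

text \<open>Since \<open>pprt (- x) = pprt x - x\<close>, the summand \<open>pprt x\<close> can be
  pulled out of the infimum, and what remains is \<open>- pprt x\<close>.\<close>

lemma inf_pprt_pprt_uminus:
  fixes x :: "'a::lattice_ab_group_add"
  shows "inf (pprt x) (pprt (- x)) = 0"
proof -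
  have "pprt (- x) = pprt x - x"
    using prts[of x] by (simp add: pprt_neg algebra_simps)
  then have "inf (pprt x) (pprt (- x)) = pprt x + inf 0 (- x)"
    by (simp add: add_inf_distrib_left)
  also have "inf 0 (- x) = - pprt x"
    by (simp add: pprt_def neg_sup_eq_inf inf_commute)
  finally show ?thesis by simp
qed

lemma scaleR_inf:
  fixes x y :: "'a::banach_lattice"
  assumes a: "0 < a"
  shows "a *\<^sub>R inf x y = inf (a *\<^sub>R x) (a *\<^sub>R y)"
proof (rule order_antisym)
  show "a *\<^sub>R inf x y \<le> inf (a *\<^sub>R x) (a *\<^sub>R y)"
    using a by (simp add: scaleR_left_mono)
  have "inverse a *\<^sub>R inf (a *\<^sub>R x) (a *\<^sub>R y) \<le> inverse a *\<^sub>R (a *\<^sub>R x)"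
    "inverse a *\<^sub>R inf (a *\<^sub>R x) (a *\<^sub>R y) \<le> inverse a *\<^sub>R (a *\<^sub>R y)"
    using a by (intro scaleR_left_mono; simp)+
  then have "inverse a *\<^sub>R inf (a *\<^sub>R x) (a *\<^sub>R y) \<le> inf x y" using a by simp
  then have "a *\<^sub>R (inverse a *\<^sub>R inf (a *\<^sub>R x) (a *\<^sub>R y)) \<le> a *\<^sub>R inf x y"
    using a by (intro scaleR_left_mono) auto
  then show "inf (a *\<^sub>R x) (a *\<^sub>R y) \<le> a *\<^sub>R inf x y" using a by simp
qed

lemma inf_pprt_uminus_scaleR_pprt:
  fixes x :: "'a::banach_lattice"
  assumes "0 \<le> t"
  shows "inf (pprt (- x)) (t *\<^sub>R pprt x) = 0"
proof (rule order_antisym)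
  \<comment> \<open>Enlarging both coefficients to the common value \<open>s > 0\<close> lets it
    factor out of the infimum.\<close>
  define s where "s = max 1 t"
  have "1 *\<^sub>R pprt (- x) \<le> s *\<^sub>R pprt (- x)" "t *\<^sub>R pprt x \<le> s *\<^sub>R pprt x"
    by (intro scaleR_right_mono; simp add: s_def)+
  then have "inf (pprt (- x)) (t *\<^sub>R pprt x) \<le> inf (s *\<^sub>R pprt x) (s *\<^sub>R pprt (- x))"
    by (simp add: le_infI1 le_infI2)
  also have "\<dots> = 0"
    by (simp add: s_def scaleR_inf[symmetric] inf_pprt_pprt_uminus)
  finally show "inf (pprt (- x)) (t *\<^sub>R pprt x) \<le> 0" .
qed (use assms in \<open>simp add: scaleR_nonneg_nonneg\<close>)

text \<open>The elements dominated by a member of \<open>A\<close> already form a solid set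
  containing \<open>A\<close>.\<close>

lemma solid_hull_dominated:
  assumes "y \<in> solid hull A"
  obtains x where "x \<in> A" "\<bar>y\<bar> \<le> \<bar>x\<bar>"
proof -
  have "solid hull A \<subseteq> {y. \<exists>x\<in>A. \<bar>y\<bar> \<le> \<bar>x\<bar>}"
    by (rule hull_minimal) (auto simp: solid_def intro: order_trans)
  with assms that show ?thesis by blast
qed

lemma bounded_solid_hull:
  assumes "bounded A"
  shows "bounded (solid hull A)"
proof -
  obtain C where C: "\<And>x. x \<in> A \<Longrightarrow> norm x \<le> C"
    using assms by (auto simp: bounded_iff)
  have "norm y \<le> C" if "y \<in> solid hull A" for y
    using that C by (meson solid_hull_dominated norm_abs_mono order_trans)
  then show ?thesis by (auto simp: bounded_iff)
qed

section \<open>Functionals dominated by a positive functional\<close>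

text \<open>An additive, positively homogeneous, bounded function on the positive cone extends by
  differences, because every element is a difference of positive ones.\<close>

lemma positive_functional_extension:
  fixes p :: "'a::banach_lattice \<Rightarrow> real"
  assumes add: "\<And>x y. 0 \<le> x \<Longrightarrow> 0 \<le> y \<Longrightarrow> p (x + y) = p x + p y"
    and scale: "\<And>a x. 0 < a \<Longrightarrow> 0 \<le> x \<Longrightarrow> p (a *\<^sub>R x) = a * p x"
    and bound: "\<And>x. 0 \<le> x \<Longrightarrow> \<bar>p x\<bar> \<le> C * norm x"
  obtains g :: "'a \<Rightarrow>\<^sub>L real" where "\<And>x. 0 \<le> x \<Longrightarrow> blinfun_apply g x = p x"
proof -
  define H where "H = (\<lambda>x. p (pprt x) - p (pprt (- x)))"
  have pp: "x = pprt x - pprt (- x)" for x :: 'a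
    using prts[of x] by (simp add: pprt_neg)
  \<comment> \<open>Independence of the decomposition: moving the subtracted terms across gives an
    equation between sums of positive elements, where \<open>p\<close> is additive.\<close>
  have H_diff: "H (u - v) = p u - p v" if "0 \<le> u" "0 \<le> v" for u v
  proof -
    have "pprt (u - v) + v = u + pprt (- (u - v))"
      using pp[of "u - v"] by (metis add.commute add_diff_eq diff_eq_eq)
    then have "p (pprt (u - v)) + p v = p u + p (pprt (- (u - v)))"
      using that by (metis add zero_le_pprt)
    then show ?thesis by (simp add: H_def)
  qed
  have p0: "p 0 = 0" using add[of 0 0] by simp
  have H_pos: "H x = p x" if "0 \<le> x" for x
    using H_diff[of x 0] that p0 by simp
  have H_add: "H (x + y) = H x + H y" for x y
  proof -
    have "x + y = (pprt x + pprt y) - (pprt (- x) + pprt (- y))"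
      using pp[of x] pp[of y] by (metis add_diff_add)
    then have "H (x + y) = p (pprt x + pprt y) - p (pprt (- x) + pprt (- y))"
      by (metis H_diff add_nonneg_nonneg zero_le_pprt)
    then show ?thesis by (simp add: H_def add)
  qed
  have H_neg: "H (- x) = - H x" for x by (simp add: H_def)
  have H_scale_pos: "H (a *\<^sub>R x) = a * H x" if "0 < a" for a x
  proof -
    have "a *\<^sub>R x = a *\<^sub>R pprt x - a *\<^sub>R pprt (- x)"
      using pp[of x] by (metis scaleR_diff_right)
    then have "H (a *\<^sub>R x) = p (a *\<^sub>R pprt x) - p (a *\<^sub>R pprt (- x))"
      using that by (metis H_diff less_imp_le scaleR_nonneg_nonneg zero_le_pprt)
    then show ?thesis using that by (simp add: H_def scale right_diff_distrib)
  qed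
  have H_scale: "H (a *\<^sub>R x) = a *\<^sub>R H x" for a x
  proof (cases a "0::real" rule: linorder_cases)
    case less
    then show ?thesis using H_scale_pos[of "- a" x] H_neg[of "a *\<^sub>R x"] by simp
  next
    case equal
    then show ?thesis by (simp add: H_pos p0)
  qed (simp add: H_scale_pos)
  have H_bound: "norm (H x) \<le> norm x * (\<bar>C\<bar> + \<bar>C\<bar>)" for x
  proof -
    have part: "\<bar>p (pprt z)\<bar> \<le> \<bar>C\<bar> * norm z" for z
    proof -
      have "norm (pprt z) \<le> norm z"
        by (rule norm_abs_mono) (simp add: pprt_def abs_of_nonneg abs_ge_self)
      then have "C * norm (pprt z) \<le> \<bar>C\<bar> * norm z"
        by (intro mult_mono) auto
      with bound[of "pprt z"] show ?thesis by simp
    qed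
    have "norm (H x) \<le> \<bar>p (pprt x)\<bar> + \<bar>p (pprt (- x))\<bar>"
      unfolding H_def real_norm_def by (rule abs_triangle_ineq4)
    with part[of x] part[of "- x"] show ?thesis by (simp add: algebra_simps)
  qed
  have "bounded_linear H"
    by (rule bounded_linear_intro[OF H_add H_scale H_bound])
  then have "blinfun_apply (Blinfun H) x = p x" if "0 \<le> x" for x
    using that by (simp add: bounded_linear_Blinfun_apply H_pos)
  then show ?thesis by (rule that)
qed

lemma dual_le_mono:
  assumes "dual_le 0 h" "x \<le> y"
  shows "blinfun_apply h x \<le> blinfun_apply h y"
proof -
  have "0 \<le> blinfun_apply h (y - x)"
    using assms by (simp add: dual_le_def blinfun.zero_left)
  then show ?thesis by (simp add: blinfun.diff_right)
qed

text \<open>The functional \<open>k\<close> is the component of \<open>h\<close> carried by the band generated by \<open>u\<close>.\<close>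

lemma band_component_exists:
  fixes h :: "'a::banach_lattice \<Rightarrow>\<^sub>L real"
  assumes h: "dual_le 0 h" and u: "0 \<le> u"
  obtains k :: "'a \<Rightarrow>\<^sub>L real" where "dual_le 0 k" "dual_le k h"
    "\<And>z. 0 \<le> z \<Longrightarrow> blinfun_apply k z = (SUP t\<in>{0..}. blinfun_apply h (inf z (t *\<^sub>R u)))"
proof -
  define F where "F = (\<lambda>z t. blinfun_apply h (inf z (t *\<^sub>R u)))"
  define p where "p = (\<lambda>z. SUP t\<in>{0..}. F z t)"
  note mono = dual_le_mono[OF h]
  have F_le: "F z t \<le> blinfun_apply h z" for z t
    by (simp add: F_def mono)
  have F_p: "F z t \<le> p z" if "0 \<le> t" for z t
    unfolding p_def using that F_le by (intro cSUP_upper bdd_aboveI2) auto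
  have p_le: "p z \<le> c" if "\<And>t. 0 \<le> t \<Longrightarrow> F z t \<le> c" for z c
    unfolding p_def using that by (intro cSUP_least) auto
  have tu: "0 \<le> t *\<^sub>R u" if "0 \<le> t" for t
    using that u by (simp add: scaleR_nonneg_nonneg)
  have p_add: "p (x + y) = p x + p y" if xy: "0 \<le> x" "0 \<le> y" for x y
  proof (rule order_antisym)
    show "p (x + y) \<le> p x + p y"
    proof (rule p_le)
      fix t :: real assume t: "0 \<le> t"
      have "F (x + y) t \<le> F x t + F y t"
        using mono[OF inf_add_le[OF xy tu[OF t]]] by (simp add: F_def blinfun.add_right)
      with F_p[OF t, of x] F_p[OF t, of y] show "F (x + y) t \<le> p x + p y" by simp
    qed
    \<comment> \<open>The parameter \<open>s + t\<close> serves both terms at once, so the suprema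
      over \<open>s\<close> and over \<open>t\<close> can then be taken one after the other.\<close>
    have "F x s + F y t \<le> p (x + y)" if "0 \<le> s" "0 \<le> t" for s t
    proof -
      have "inf x (s *\<^sub>R u) + inf y (t *\<^sub>R u) \<le> inf (x + y) ((s + t) *\<^sub>R u)"
        by (simp add: scaleR_left_distrib add_mono)
      from mono[OF this] have "F x s + F y t \<le> F (x + y) (s + t)"
        by (simp add: F_def blinfun.add_right)
      also have "\<dots> \<le> p (x + y)" using that by (intro F_p) simp
      finally show ?thesis .
    qed
    then have "p x \<le> p (x + y) - F y t" if "0 \<le> t" for t
      using that by (intro p_le) (simp add: algebra_simps)
    then have "F y t \<le> p (x + y) - p x" if "0 \<le> t" for t
      using that by (simp add: algebra_simps)
    then have "p y \<le> p (x + y) - p x" by (rule p_le)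
    then show "p x + p y \<le> p (x + y)" by simp
  qed
  have p_scale_le: "p (a *\<^sub>R x) \<le> a * p x" if a: "0 < a" for a x
  proof (rule p_le)
    fix t :: real assume t: "0 \<le> t"
    \<comment> \<open>Scaling only reparametrises the supremum, \<open>t / a\<close> again ranging
      over the nonnegative reals.\<close>
    have "inf (a *\<^sub>R x) (t *\<^sub>R u) = a *\<^sub>R inf x ((t / a) *\<^sub>R u)"
      using a by (simp add: scaleR_inf)
    then have "F (a *\<^sub>R x) t = a * F x (t / a)"
      by (simp add: F_def blinfun.scaleR_right)
    also have "\<dots> \<le> a * p x" using a t F_p[of "t / a" x] by simp
    finally show "F (a *\<^sub>R x) t \<le> a * p x" .
  qed
  have p_scale: "p (a *\<^sub>R x) = a * p x" if a: "0 < a" for a x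
  proof (rule order_antisym)
    show "a * p x \<le> p (a *\<^sub>R x)"
      using p_scale_le[of "inverse a" "a *\<^sub>R x"] a by (simp add: field_simps)
  qed (rule p_scale_le[OF a])
  have p_nonneg: "0 \<le> p x" if "0 \<le> x" for x
    using F_p[of 0 x] that by (simp add: F_def inf_absorb2 blinfun.zero_right)
  have p_h: "p x \<le> blinfun_apply h x" for x
    by (rule p_le[OF F_le])
  have p_bound: "\<bar>p x\<bar> \<le> norm h * norm x" if "0 \<le> x" for x
    using p_nonneg[OF that] p_h[of x] norm_blinfun[of h x] by simp
  obtain k :: "'a \<Rightarrow>\<^sub>L real" where k: "\<And>x. 0 \<le> x \<Longrightarrow> blinfun_apply k x = p x"
    using positive_functional_extension[of p "norm h"] p_add p_scale p_bound by blast
  show ?thesis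
  proof (rule that)
    show "dual_le 0 k" "dual_le k h"
      using p_nonneg p_h by (auto simp: dual_le_def k)
    show "blinfun_apply k z = (SUP t\<in>{0..}. blinfun_apply h (inf z (t *\<^sub>R u)))"
      if "0 \<le> z" for z
      using k[OF that] by (simp add: p_def F_def)
  qed
qed

text \<open>With \<open>k\<close> the component of \<open>h\<close> carried by the band of
  \<open>pprt x\<close>, the functional \<open>g = 2k - h\<close> keeps \<open>h\<close> on that
  band and reverses its sign at \<open>pprt (- x)\<close>, so both parts of \<open>x\<close>
  contribute positively.\<close>

lemma dominated_functional_attaining_abs:
  fixes h :: "'a::banach_lattice \<Rightarrow>\<^sub>L real"
  assumes h: "dual_le 0 h"
  obtains g :: "'a \<Rightarrow>\<^sub>L real" where "dual_le g h" "dual_le (- g) h"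
    "blinfun_apply g x = blinfun_apply h \<bar>x\<bar>"
proof -
  obtain k :: "'a \<Rightarrow>\<^sub>L real" where k: "dual_le 0 k" "dual_le k h"
    and k_apply: "\<And>z. 0 \<le> z \<Longrightarrow>
      blinfun_apply k z = (SUP t\<in>{0..}. blinfun_apply h (inf z (t *\<^sub>R pprt x)))"
    using band_component_exists[OF h zero_le_pprt[of x]] by metis
  have "blinfun_apply k (pprt x) = blinfun_apply h (pprt x)"
  proof (rule order_antisym)
    show "blinfun_apply k (pprt x) \<le> blinfun_apply h (pprt x)"
      using k(2) by (simp add: dual_le_def)
    \<comment> \<open>The term \<open>t = 1\<close> of the supremum already equals
      \<open>h (pprt x)\<close>.\<close>
    have "blinfun_apply h (inf (pprt x) (1 *\<^sub>R pprt x))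
        \<le> (SUP t\<in>{0..}. blinfun_apply h (inf (pprt x) (t *\<^sub>R pprt x)))"
      by (rule cSUP_upper) (auto intro!: bdd_aboveI2[where M = "blinfun_apply h (pprt x)"]
          dual_le_mono[OF h])
    then show "blinfun_apply h (pprt x) \<le> blinfun_apply k (pprt x)"
      by (simp add: k_apply)
  qed
  moreover have "blinfun_apply k (pprt (- x)) = 0"
    using k_apply[of "pprt (- x)"]
    by (simp add: inf_pprt_uminus_scaleR_pprt blinfun.zero_right cong: SUP_cong_simp)
  moreover have "\<bar>x\<bar> = pprt x + pprt (- x)"
    using abs_prts[of x] by (simp add: pprt_neg)
  moreover have "blinfun_apply l x = blinfun_apply l (pprt x) - blinfun_apply l (pprt (- x))"
    for l :: "'a \<Rightarrow>\<^sub>L real"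
    using prts[of x] by (metis blinfun.diff_right diff_minus_eq_add minus_minus pprt_neg)
  ultimately have "blinfun_apply (k + k - h) x = blinfun_apply h \<bar>x\<bar>"
    by (simp add: blinfun.add_left blinfun.diff_left blinfun.add_right)
  \<comment> \<open>These are the bounds \<open>k \<le> h\<close> and \<open>0 \<le> k\<close> in
    turn.\<close>
  moreover have "dual_le (k + k - h) h" "dual_le (- (k + k - h)) h"
    using k by (fastforce simp: dual_le_def blinfun.add_left blinfun.diff_left
        blinfun.minus_left)+
  ultimately show ?thesis using that by blast
qed

section \<open>Moduli in the dual\<close>

lemma dual_le_dual_abs: "dual_le f (dual_abs f)" "dual_le (- f) (dual_abs f)"
  using is_dual_sup_dual_sup[of f "- f"] by (auto simp: dual_abs_def is_dual_sup_def)

lemma dual_abs_least: "dual_le g h \<Longrightarrow> dual_le (- g) h \<Longrightarrow> dual_le (dual_abs g) h"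
  using is_dual_sup_dual_sup[of g "- g"] by (auto simp: dual_abs_def is_dual_sup_def)

lemma dual_abs_nonneg: "dual_le 0 (dual_abs f)"
  using dual_le_dual_abs[of f] by (fastforce simp: dual_le_def blinfun.minus_left)

text \<open>On the positive cone the bound is the hypothesis. Applied to the positive elements
  \<open>\<bar>x\<bar> + x\<close> and \<open>\<bar>x\<bar> - x\<close>, whose difference is
  \<open>2x\<close> and whose sum is \<open>2\<bar>x\<bar>\<close>, it gives the general
  case.\<close>

lemma abs_apply_le_of_dominated:
  assumes "dual_le f h" "dual_le (- f) h"
  shows "\<bar>blinfun_apply f x\<bar> \<le> blinfun_apply h \<bar>x\<bar>"
proof -
  have pos: "0 \<le> \<bar>x\<bar> + x" "0 \<le> \<bar>x\<bar> - x"
    using abs_ge_minus_self[of x] abs_ge_self[of x] by (simp_all add: minus_le_iff add.commute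
        neg_le_iff_le flip: diff_minus_eq_add)
  have "\<bar>blinfun_apply f y\<bar> \<le> blinfun_apply h y" if "0 \<le> y" for y
    using assms that by (auto simp: dual_le_def blinfun.minus_left abs_le_iff)
  from this[OF pos(1)] this[OF pos(2)] show ?thesis
    unfolding blinfun.add_right blinfun.diff_right by linarith
qed

text \<open>A common lower bound of two smaller moduli is one of the larger moduli too, hence is at
  most 0; and 0 itself is a lower bound.\<close>

lemma dual_disjoint_seq_dominated:
  assumes "dual_disjoint_seq f" and le: "\<And>n. dual_le (dual_abs (g n)) (dual_abs (f n))"
  shows "dual_disjoint_seq g"
  unfolding dual_disjoint_seq_def
proof (intro allI impI)
  fix n m :: nat assume "n \<noteq> m"
  then have "is_dual_inf (dual_abs (f n)) (dual_abs (f m)) 0"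
    using assms(1) is_dual_inf_dual_inf[of "dual_abs (f n)" "dual_abs (f m)"]
    by (simp add: dual_disjoint_seq_def)
  then have "is_dual_inf (dual_abs (g n)) (dual_abs (g m)) 0"
    unfolding is_dual_inf_def using dual_abs_nonneg le dual_le_trans by blast
  then show "dual_inf (dual_abs (g n)) (dual_abs (g m)) = 0" by (rule dual_inf_eqI)
qed

lemma weak_star_null_dominated:
  assumes "weak_star_null h" and "\<And>n. dual_le (g n) (h n)" "\<And>n. dual_le (- g n) (h n)"
  shows "weak_star_null g"
  unfolding weak_star_null_iff
proof
  fix x
  have "(\<lambda>n. blinfun_apply (h n) \<bar>x\<bar>) \<longlonglongrightarrow> 0"
    using assms(1) by (simp add: weak_star_null_iff)
  then show "(\<lambda>n. blinfun_apply (g n) x) \<longlonglongrightarrow> 0"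
    by (rule Lim_null_comparison[rotated]) (simp add: abs_apply_le_of_dominated assms)
qed

theorem lemma2p1:
  fixes A :: "'a::banach_lattice set"
  assumes "property_d TYPE('a)"
    and "almost_limited A"
  shows "almost_limited (solid hull A)"
  unfolding almost_limited_def
proof (intro conjI allI impI)
  show "bounded (solid hull A)"
    using assms(2) by (simp add: almost_limited_def bounded_solid_hull)
  fix f :: "nat \<Rightarrow> 'a \<Rightarrow>\<^sub>L real"
  assume f: "dual_disjoint_seq f" "weak_star_null f"
  then have f_abs: "weak_star_null (\<lambda>n. dual_abs (f n))"
    using assms(1) by (simp add: property_d_def)
  show "uniform_limit (solid hull A) (\<lambda>n. blinfun_apply (f n)) (\<lambda>x. 0) sequentially"
  proof (rule uniform_limitI)
    fix e :: real assume e: "0 < e"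
    \<comment> \<open>For fixed \<open>e\<close>, one bad point per index suffices: if
      \<open>f n\<close> reaches \<open>e\<close> at some \<open>y\<close> of the hull,
      \<open>g\<close> is built for a single \<open>x\<close> in \<open>A\<close> dominating
      \<open>y\<close>. Otherwise \<open>g = f n\<close> will do.\<close>
    have "\<exists>g. dual_le g (dual_abs (f n)) \<and> dual_le (- g) (dual_abs (f n)) \<and>
        ((\<forall>x\<in>A. \<bar>blinfun_apply g x\<bar> < e) \<longrightarrow> (\<forall>y\<in>solid hull A. \<bar>blinfun_apply (f n) y\<bar> < e))"
      for n
    proof (cases "\<forall>y\<in>solid hull A. \<bar>blinfun_apply (f n) y\<bar> < e")
      case True
      then show ?thesis using dual_le_dual_abs by blast
    next
      case False
      then obtain y where y: "y \<in> solid hull A" "e \<le> \<bar>blinfun_apply (f n) y\<bar>"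
        by (auto simp: not_less)
      then obtain x where x: "x \<in> A" "\<bar>y\<bar> \<le> \<bar>x\<bar>" using solid_hull_dominated by blast
      obtain g where g: "dual_le g (dual_abs (f n))" "dual_le (- g) (dual_abs (f n))"
          "blinfun_apply g x = blinfun_apply (dual_abs (f n)) \<bar>x\<bar>"
        using dominated_functional_attaining_abs[OF dual_abs_nonneg] by blast
      have "e \<le> blinfun_apply (dual_abs (f n)) \<bar>y\<bar>"
        using y(2) abs_apply_le_of_dominated[OF dual_le_dual_abs] order_trans by blast
      also have "\<dots> \<le> blinfun_apply g x"
        unfolding g(3) by (rule dual_le_mono[OF dual_abs_nonneg x(2)])
      finally have "\<not> \<bar>blinfun_apply g x\<bar> < e" by simp
      then show ?thesis using g(1,2) x(1) by blast
    qed
    then obtain g where g: "\<And>n. dual_le (g n) (dual_abs (f n))"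
        "\<And>n. dual_le (- g n) (dual_abs (f n))"
      and small: "\<And>n. \<forall>x\<in>A. \<bar>blinfun_apply (g n) x\<bar> < e \<Longrightarrow>
        \<forall>y\<in>solid hull A. \<bar>blinfun_apply (f n) y\<bar> < e"
      by metis
    \<comment> \<open>Both properties pass from the moduli of \<open>f\<close> to \<open>g\<close>
      by domination, so the almost limited set \<open>A\<close> can be tested against
      \<open>g\<close>.\<close>
    have "dual_disjoint_seq g"
      by (rule dual_disjoint_seq_dominated[OF f(1)]) (simp add: dual_abs_least g)
    moreover have "weak_star_null g"
      by (rule weak_star_null_dominated[OF f_abs g])
    ultimately have "uniform_limit A (\<lambda>n. blinfun_apply (g n)) (\<lambda>x. 0) sequentially"
      using assms(2) by (simp add: almost_limited_def)
    from uniform_limitD[OF this e]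
    show "\<forall>\<^sub>F n in sequentially. \<forall>y\<in>solid hull A. dist (blinfun_apply (f n) y) 0 < e"
      by eventually_elim (use small in \<open>simp add: dist_real_def\<close>)
  qed
qed

end
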